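(* For every $n\ge 1$ and every $\pi\in\mathcal{S}_n$, \[\mathrm{IPF}(n,\pi)=n!\cdot\mathrm{PF}(n,\pi)=n!\prod_{i=1}^n a_i(\pi),\qquad \mathrm{IPF}(n)=n!\cdot\mathrm{PF}(n)=n!\,(n+1)^{n-1}.\]
   Context: Let $[n]=\{1,\dots,n\}$, $\mathcal{S}_n$ the permutations of $[n]$ in one-line notation, and $\pi_i^{-1}$ the position $j$ with $\pi_j=i$. A tuple $(C_1,\dots,C_n)$ of non-empty subsets of $[n]$ is a subset parking function with outcome $\pi$ if for every $1\le i\le n$, $\pi_i^{-1}$ is the smallest element of $C_i\setminus\{\pi_{i'}^{-1}:i'<i\}$. It is an interval parking function if every $C_i$ is an interval $\{a,a+1,\dots,b\}\subseteq[n]$; $\mathrm{IPF}(n,\pi)$ counts interval parking functions with outcome $\pi$ and $\mathrm{IPF}(n)=\sum_\pi\mathrm{IPF}(n,\pi)$. A (classical) parking function is a subset parking function with every $C_i$ of the form $[c_i,n]=\{c_i,\dots,n\}$; $\mathrm{PF}(n,\pi)$ counts these with outcome $\pi$ and $\mathrm{PF}(n)$ counts all of them. For $1\le i\le n$, $a_i(\pi)$ is the largest $j$ with $1\le j\le i$ such that $\pi_i\ge\pi_{i'}$ for all $i-j+1\le i'\le i$. *)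

theory Defs
  imports Complex_Main "HOL-Library.FuncSet" "HOL-Combinatorics.Permutations"
begin

text \<open>
  Tuples $(C_1,\dots,C_n)$ are functions that are \<^const>\<open>undefined\<close> outside \<open>{1..n}\<close>, so that
  counting functions is counting tuples. A permutation of \<open>[n]\<close> is a function with
  \<open>\<pi> permutes {1..n}\<close>; then \<open>inv \<pi> i\<close> is the position of \<open>i\<close> in the one-line notation.
\<close>

definition subset_tuples :: "nat \<Rightarrow> (nat \<Rightarrow> nat set) set" where
  "subset_tuples n = {1..n} \<rightarrow>\<^sub>E (Pow {1..n} - {{}})"

definition is_smallest :: "nat \<Rightarrow> nat set \<Rightarrow> bool" where
  "is_smallest x S \<longleftrightarrow> x \<in> S \<and> (\<forall>y\<in>S. x \<le> y)"

definition subset_parking_with_outcome ::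
    "nat \<Rightarrow> (nat \<Rightarrow> nat) \<Rightarrow> (nat \<Rightarrow> nat set) \<Rightarrow> bool" where
  "subset_parking_with_outcome n \<pi> C \<longleftrightarrow>
     C \<in> subset_tuples n \<and> \<pi> permutes {1..n} \<and>
     (\<forall>i\<in>{1..n}. is_smallest (inv \<pi> i) (C i - {inv \<pi> i' |i'. 1 \<le> i' \<and> i' < i}))"

definition subset_parking :: "nat \<Rightarrow> (nat \<Rightarrow> nat set) \<Rightarrow> bool" where
  "subset_parking n C \<longleftrightarrow> (\<exists>\<pi>. subset_parking_with_outcome n \<pi> C)"

definition interval_tuple :: "nat \<Rightarrow> (nat \<Rightarrow> nat set) \<Rightarrow> bool" where
  "interval_tuple n C \<longleftrightarrow> (\<forall>i\<in>{1..n}. \<exists>a\<in>{1..n}. \<exists>b\<in>{1..n}. C i = {a..b})"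

definition classical_tuple :: "nat \<Rightarrow> (nat \<Rightarrow> nat set) \<Rightarrow> bool" where
  "classical_tuple n C \<longleftrightarrow> (\<forall>i\<in>{1..n}. \<exists>c\<in>{1..n}. C i = {c..n})"

definition IPF_outcome :: "nat \<Rightarrow> (nat \<Rightarrow> nat) \<Rightarrow> nat" where
  "IPF_outcome n \<pi> = card {C. subset_parking_with_outcome n \<pi> C \<and> interval_tuple n C}"

definition IPF :: "nat \<Rightarrow> nat" where
  "IPF n = (\<Sum>\<pi> | \<pi> permutes {1..n}. IPF_outcome n \<pi>)"

definition PF_outcome :: "nat \<Rightarrow> (nat \<Rightarrow> nat) \<Rightarrow> nat" where
  "PF_outcome n \<pi> = card {C. subset_parking_with_outcome n \<pi> C \<and> classical_tuple n C}"

definition PF :: "nat \<Rightarrow> nat" where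
  "PF n = card {C. subset_parking n C \<and> classical_tuple n C}"

definition run_length :: "(nat \<Rightarrow> nat) \<Rightarrow> nat \<Rightarrow> nat" where
  "run_length \<pi> i = Max {j. 1 \<le> j \<and> j \<le> i \<and> (\<forall>i'\<in>{i - j + 1..i}. \<pi> i \<ge> \<pi> i')}"

end

theory Submission imports Defs "HOL-Number_Theory.Cong" begin

text \<open>
  Fix an outcome \<open>\<pi>\<close> and a car \<open>i\<close> parked at \<open>q = inv \<pi> i\<close>. An interval \<open>{a..b}\<close> sends car \<open>i\<close> to
  \<open>q\<close> iff \<open>a \<le> q \<le> b\<close> and all spots in \<open>{a..<q}\<close> hold earlier cars, so there are \<open>run_length \<pi> q\<close>
  choices of \<open>a\<close> and, independently, \<open>n + 1 - q\<close> choices of \<open>b\<close>; the latter multiply to \<open>n!\<close>.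
  The total number of parking functions is found by Pollak's argument: on a circle with the
  \<open>n + 1\<close> spots \<open>0, \<dots>, n\<close> every preference function parks all cars and leaves one spot empty,
  rotations permute the empty spot cyclically, and spot \<open>0\<close> stays empty exactly for the
  classical parking functions.
\<close>

section \<open>Counting with a fixed outcome\<close>

text \<open>As \<open>\<pi> x\<close> is the car in spot \<open>x\<close>, the bound says that every
  spot from \<open>a\<close> to \<open>q\<close> holds a car arriving no later than the one in
  \<open>q\<close>.\<close>

definition left_ends :: "(nat \<Rightarrow> nat) \<Rightarrow> nat \<Rightarrow> nat set" where
  "left_ends \<pi> q = {a. 1 \<le> a \<and> a \<le> q \<and> (\<forall>x\<in>{a..q}. \<pi> x \<le> \<pi> q)}"

text \<open>The admissible lengths \<open>j\<close> in \<open>run_length\<close> are closed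
  downwards, so they form \<open>{1..M}\<close> and their maximum is also their number. The
  reflection \<open>a = q + 1 - j\<close> turns them into left ends.\<close>

lemma card_left_ends:
  assumes "1 \<le> q"
  shows "card (left_ends \<pi> q) = run_length \<pi> q"
proof -
  define J where "J = {j. 1 \<le> j \<and> j \<le> q \<and> (\<forall>i'\<in>{q - j + 1..q}. \<pi> q \<ge> \<pi> i')}"
  have fin: "finite J" by (rule finite_subset[of _ "{..q}"]) (auto simp: J_def)
  have "1 \<in> J" using assms by (auto simp: J_def)
  define M where "M = Max J"
  have M: "M \<in> J" "\<And>j. j \<in> J \<Longrightarrow> j \<le> M"
    using \<open>1 \<in> J\<close> fin Max_in unfolding M_def by auto
  have "j \<in> J" if "1 \<le> j" "j \<le> M" for j
    using M(1) that by (auto simp: J_def)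
  moreover have "1 \<le> j" if "j \<in> J" for j
    using that by (simp add: J_def)
  ultimately have "J = {1..M}" using M(2) by (intro set_eqI) (metis atLeastAtMost_iff)
  then have cJ: "card J = Max J" unfolding M_def[symmetric] by simp
  have "left_ends \<pi> q = (\<lambda>j. q + 1 - j) ` J"
  proof
    show "left_ends \<pi> q \<subseteq> (\<lambda>j. q + 1 - j) ` J"
    proof
      fix a assume a: "a \<in> left_ends \<pi> q"
      then have "q + 1 - a \<in> J" "a = q + 1 - (q + 1 - a)"
        by (auto simp: left_ends_def J_def)
      then show "a \<in> (\<lambda>j. q + 1 - j) ` J" by blast
    qed
    show "(\<lambda>j. q + 1 - j) ` J \<subseteq> left_ends \<pi> q"
      by (auto simp: left_ends_def J_def)
  qed
  moreover have "inj_on (\<lambda>j. q + 1 - j) J"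
    by (auto simp: inj_on_def J_def)
  ultimately show ?thesis
    using cJ unfolding run_length_def J_def[symmetric] by (simp add: card_image)
qed

lemma earlier_spots:
  fixes n :: nat
  assumes "\<pi> permutes {1..n}" "i \<in> {1..n}"
  shows "x \<in> {inv \<pi> i' |i'. 1 \<le> i' \<and> i' < i} \<longleftrightarrow> x \<in> {1..n} \<and> \<pi> x < i"
proof
  assume "x \<in> {inv \<pi> i' |i'. 1 \<le> i' \<and> i' < i}"
  then obtain i' where i': "x = inv \<pi> i'" "1 \<le> i'" "i' < i" by auto
  then have "i' \<in> {1..n}" using assms(2) by simp
  then show "x \<in> {1..n} \<and> \<pi> x < i"
    using i' assms(1) permutes_inverses(1)[OF assms(1)] permutes_inv permutes_in_image
    by metis
next
  assume "x \<in> {1..n} \<and> \<pi> x < i"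
  moreover have "inv \<pi> (\<pi> x) = x" by (rule permutes_inverses(2)[OF assms(1)])
  moreover have "\<pi> x \<in> {1..n}" if "x \<in> {1..n}" using that permutes_in_image[OF assms(1)] by blast
  ultimately show "x \<in> {inv \<pi> i' |i'. 1 \<le> i' \<and> i' < i}"
    by (auto intro!: exI[of _ "\<pi> x"])
qed

text \<open>The spots in \<open>{a..<q}\<close> must all be taken by earlier cars, while beyond
  \<open>q\<close> nothing matters. Hence the requirements on the two endpoints decouple, which
  yields the product formula.\<close>

lemma is_smallest_interval_iff:
  assumes "\<pi> permutes {1..n}" "i \<in> {1..n}" "1 \<le> a" "b \<le> n"
  shows "is_smallest (inv \<pi> i) ({a..b} - {inv \<pi> i' |i'. 1 \<le> i' \<and> i' < i})
     \<longleftrightarrow> a \<in> left_ends \<pi> (inv \<pi> i) \<and> inv \<pi> i \<le> b"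
proof -
  define q where "q = inv \<pi> i"
  have pq: "\<pi> q = i" unfolding q_def by (rule permutes_inverses(1)[OF assms(1)])
  have inj: "x = q" if "\<pi> x = i" for x
    using that permutes_inverses(2)[OF assms(1)] q_def by metis
  have "is_smallest q ({a..b} - {inv \<pi> i' |i'. 1 \<le> i' \<and> i' < i})
     \<longleftrightarrow> a \<le> q \<and> q \<le> b \<and> (\<forall>y\<in>{a..b}. i \<le> \<pi> y \<longrightarrow> q \<le> y)"
    unfolding is_smallest_def Diff_iff Ball_def earlier_spots[OF assms(1,2)]
    using assms(3,4) pq by (auto simp: not_less)
  also have "\<dots> \<longleftrightarrow> a \<in> left_ends \<pi> q \<and> q \<le> b"
  proof (intro iffI conjI)
    assume L: "a \<le> q \<and> q \<le> b \<and> (\<forall>y\<in>{a..b}. i \<le> \<pi> y \<longrightarrow> q \<le> y)"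
    have "\<pi> x \<le> i" if "x \<in> {a..q}" for x
    proof (rule ccontr)
      assume "\<not> \<pi> x \<le> i"
      then have "q \<le> x" using L that by auto
      then have "x = q" using that by simp
      then show False using \<open>\<not> \<pi> x \<le> i\<close> pq by simp
    qed
    with L show "a \<in> left_ends \<pi> q" using assms(3) pq by (auto simp: left_ends_def)
    show "q \<le> b" using L by blast
  next
    assume R: "a \<in> left_ends \<pi> q \<and> q \<le> b"
    have "q \<le> y" if "y \<in> {a..b}" "i \<le> \<pi> y" for y
    proof (rule ccontr)
      assume "\<not> q \<le> y"
      \<comment> \<open>Here \<open>y\<close> lies in \<open>{a..q}\<close>, so \<open>R\<close>
        bounds \<open>\<pi> y\<close> by \<open>i\<close> from above.\<close>
      then have "\<pi> y = i" using R that pq by (auto simp: left_ends_def intro: le_antisym)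
      then show False using inj \<open>\<not> q \<le> y\<close> by blast
    qed
    then show "a \<le> q" "q \<le> b" "\<forall>y\<in>{a..b}. i \<le> \<pi> y \<longrightarrow> q \<le> y"
      using R by (auto simp: left_ends_def)
  qed
  finally show ?thesis by (simp add: q_def)
qed

text \<open>Once the outcome is fixed, the spots taken before car \<open>i\<close> arrives do not
  depend on the tuple. The conditions on the single \<open>C i\<close> are therefore independent,
  and the tuples form a product set.\<close>

lemma interval_tuples_with_outcome:
  assumes "\<pi> permutes {1..n}"
  shows "{C. subset_parking_with_outcome n \<pi> C \<and> interval_tuple n C} =
    (\<Pi>\<^sub>E i\<in>{1..n}. (\<lambda>(a, b). {a..b}) ` (left_ends \<pi> (inv \<pi> i) \<times> {inv \<pi> i..n}))"
    (is "?L = ?R")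
proof
  show "?L \<subseteq> ?R"
  proof
    fix C assume C: "C \<in> ?L"
    show "C \<in> ?R"
    proof (rule PiE_I)
      fix i assume i: "i \<in> {1..n}"
      obtain a b where ab: "a \<in> {1..n}" "b \<in> {1..n}" "C i = {a..b}"
        using C i unfolding interval_tuple_def by blast
      have "is_smallest (inv \<pi> i) (C i - {inv \<pi> i' |i'. 1 \<le> i' \<and> i' < i})"
        using C i by (simp add: subset_parking_with_outcome_def)
      then have "a \<in> left_ends \<pi> (inv \<pi> i)" "inv \<pi> i \<le> b"
        using ab is_smallest_interval_iff[OF assms i, of a b] by auto
      then show "C i \<in> (\<lambda>(a, b). {a..b}) ` (left_ends \<pi> (inv \<pi> i) \<times> {inv \<pi> i..n})"
        using ab by (intro image_eqI[of _ _ "(a, b)"]) auto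
    next
      fix i assume "i \<notin> {1..n}"
      then show "C i = undefined"
        using C by (auto simp: subset_parking_with_outcome_def subset_tuples_def PiE_def extensional_def)
    qed
  qed
  show "?R \<subseteq> ?L"
  proof
    fix C assume C: "C \<in> ?R"
    \<comment> \<open>The bound \<open>a \<le> b\<close>, hence non-emptiness, comes from
      \<open>a \<le> inv \<pi> i \<le> b\<close>.\<close>
    have ex: "\<exists>a b. C i = {a..b} \<and> 1 \<le> a \<and> a \<le> b \<and> b \<le> n \<and> a \<in> left_ends \<pi> (inv \<pi> i) \<and> inv \<pi> i \<le> b"
      if "i \<in> {1..n}" for i
      using PiE_mem[OF C that] by (force simp: left_ends_def)
    have "C i \<in> Pow {1..n} - {{}}" if "i \<in> {1..n}" for i
      using ex[OF that] by auto
    then have "C \<in> subset_tuples n"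
      unfolding subset_tuples_def using C by (auto simp: PiE_def extensional_def Pi_def)
    moreover have "is_smallest (inv \<pi> i) (C i - {inv \<pi> i' |i'. 1 \<le> i' \<and> i' < i})"
      if i: "i \<in> {1..n}" for i
    proof -
      obtain a b where "C i = {a..b}" "1 \<le> a" "b \<le> n" "a \<in> left_ends \<pi> (inv \<pi> i)" "inv \<pi> i \<le> b"
        using ex[OF i] by blast
      then show ?thesis using is_smallest_interval_iff[OF assms i, of a b] by simp
    qed
    moreover have "interval_tuple n C"
      unfolding interval_tuple_def using ex by (meson atLeastAtMost_iff le_trans)
    ultimately show "C \<in> ?L" using assms by (simp add: subset_parking_with_outcome_def)
  qed
qed

lemma classical_tuples_with_outcome:
  assumes "\<pi> permutes {1..n}"
  shows "{C. subset_parking_with_outcome n \<pi> C \<and> classical_tuple n C} =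
    (\<Pi>\<^sub>E i\<in>{1..n}. (\<lambda>a. {a..n}) ` left_ends \<pi> (inv \<pi> i))"
    (is "?L = ?R")
proof
  have inv_in: "inv \<pi> i \<in> {1..n}" if "i \<in> {1..n}" for i
    using that permutes_in_image[OF permutes_inv[OF assms]] by blast
  show "?L \<subseteq> ?R"
  proof
    fix C assume C: "C \<in> ?L"
    show "C \<in> ?R"
    proof (rule PiE_I)
      fix i assume i: "i \<in> {1..n}"
      obtain a where ab: "a \<in> {1..n}" "C i = {a..n}"
        using C i unfolding classical_tuple_def by blast
      have "is_smallest (inv \<pi> i) (C i - {inv \<pi> i' |i'. 1 \<le> i' \<and> i' < i})"
        using C i by (simp add: subset_parking_with_outcome_def)
      then have "a \<in> left_ends \<pi> (inv \<pi> i)"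
        using ab is_smallest_interval_iff[OF assms i, of a n] by auto
      then show "C i \<in> (\<lambda>a. {a..n}) ` left_ends \<pi> (inv \<pi> i)"
        using ab by blast
    next
      fix i assume "i \<notin> {1..n}"
      then show "C i = undefined"
        using C by (auto simp: subset_parking_with_outcome_def subset_tuples_def PiE_def extensional_def)
    qed
  qed
  show "?R \<subseteq> ?L"
  proof
    fix C assume C: "C \<in> ?R"
    have ex: "\<exists>a\<in>left_ends \<pi> (inv \<pi> i). C i = {a..n}" if "i \<in> {1..n}" for i
      using PiE_mem[OF C that] by auto
    \<comment> \<open>Tails are intervals with right end \<open>n\<close>, so the outcome can be
      read off from the interval case.\<close>
    have "C i \<in> (\<lambda>(a, b). {a..b}) ` (left_ends \<pi> (inv \<pi> i) \<times> {inv \<pi> i..n})" if i: "i \<in> {1..n}" for i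
    proof -
      obtain a where "a \<in> left_ends \<pi> (inv \<pi> i)" "C i = {a..n}" using ex[OF i] by blast
      then show ?thesis using inv_in[OF i] by (intro image_eqI[of _ _ "(a, n)"]) auto
    qed
    then have "C \<in> (\<Pi>\<^sub>E i\<in>{1..n}. (\<lambda>(a, b). {a..b}) ` (left_ends \<pi> (inv \<pi> i) \<times> {inv \<pi> i..n}))"
      using C by (auto simp: PiE_def extensional_def Pi_def)
    then have "subset_parking_with_outcome n \<pi> C"
      unfolding interval_tuples_with_outcome[OF assms, symmetric] by simp
    moreover have "classical_tuple n C"
      unfolding classical_tuple_def
    proof
      fix i assume i: "i \<in> {1..n}"
      obtain a where "a \<in> left_ends \<pi> (inv \<pi> i)" "C i = {a..n}" using ex[OF i] by blast
      then show "\<exists>c\<in>{1..n}. C i = {c..n}"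
        using inv_in[OF i] by (intro bexI[of _ a]) (auto simp: left_ends_def)
    qed
    ultimately show "C \<in> ?L" by blast
  qed
qed

text \<open>The factors of the product set are indexed by cars, the run lengths by spots; reindexing
  along \<open>inv \<pi>\<close> reconciles them.\<close>

lemma PF_outcome_eq:
  assumes "\<pi> permutes {1..n}"
  shows "PF_outcome n \<pi> = (\<Prod>i=1..n. run_length \<pi> i)"
proof -
  have inv_in: "inv \<pi> i \<in> {1..n}" if "i \<in> {1..n}" for i
    using that permutes_in_image[OF permutes_inv[OF assms]] by blast
  have "PF_outcome n \<pi> = (\<Prod>i=1..n. card ((\<lambda>a. {a..n}) ` left_ends \<pi> (inv \<pi> i)))"
    unfolding PF_outcome_def classical_tuples_with_outcome[OF assms] by (simp add: card_PiE)
  also have "\<dots> = (\<Prod>i=1..n. run_length \<pi> (inv \<pi> i))"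
  proof (rule prod.cong)
    fix i assume i: "i \<in> {1..n}"
    have "inj_on (\<lambda>a. {a..n}) (left_ends \<pi> (inv \<pi> i))"
      using inv_in[OF i] by (auto simp: inj_on_def left_ends_def Icc_eq_Icc)
    then show "card ((\<lambda>a. {a..n}) ` left_ends \<pi> (inv \<pi> i)) = run_length \<pi> (inv \<pi> i)"
      using inv_in[OF i] by (simp add: card_image card_left_ends)
  qed simp
  also have "\<dots> = (\<Prod>i=1..n. run_length \<pi> i)"
    using prod.permute[OF permutes_inv[OF assms], of "run_length \<pi>"] by (simp add: comp_def)
  finally show ?thesis .
qed

text \<open>Compared with the classical case, each car gains the factor
  \<open>n + 1 - inv \<pi> i\<close> for its right end. The spots run through all of
  \<open>{1..n}\<close>, so these factors multiply to \<open>fact n\<close> for every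
  outcome.\<close>

lemma IPF_outcome_eq:
  assumes "\<pi> permutes {1..n}"
  shows "IPF_outcome n \<pi> = fact n * (\<Prod>i=1..n. run_length \<pi> i)"
proof -
  have inv_in: "inv \<pi> i \<in> {1..n}" if "i \<in> {1..n}" for i
    using that permutes_in_image[OF permutes_inv[OF assms]] by blast
  have "IPF_outcome n \<pi> =
      (\<Prod>i=1..n. card ((\<lambda>(a, b). {a..b}) ` (left_ends \<pi> (inv \<pi> i) \<times> {inv \<pi> i..n})))"
    unfolding IPF_outcome_def interval_tuples_with_outcome[OF assms] by (simp add: card_PiE)
  also have "\<dots> = (\<Prod>i=1..n. (n + 1 - inv \<pi> i) * run_length \<pi> (inv \<pi> i))"
  proof (rule prod.cong)
    fix i assume i: "i \<in> {1..n}"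
    have "inj_on (\<lambda>(a, b). {a..b}) (left_ends \<pi> (inv \<pi> i) \<times> {inv \<pi> i..n})"
      by (auto simp: inj_on_def left_ends_def Icc_eq_Icc)
    then show "card ((\<lambda>(a, b). {a..b}) ` (left_ends \<pi> (inv \<pi> i) \<times> {inv \<pi> i..n})) =
        (n + 1 - inv \<pi> i) * run_length \<pi> (inv \<pi> i)"
      using inv_in[OF i] by (simp add: card_image card_left_ends card_cartesian_product)
  qed simp
  also have "\<dots> = (\<Prod>i=1..n. (n + 1 - i) * run_length \<pi> i)"
    using prod.permute[OF permutes_inv[OF assms], of "\<lambda>i. (n + 1 - i) * run_length \<pi> i"]
    by (simp add: comp_def)
  also have "\<dots> = (\<Prod>i=1..n. n + 1 - i) * (\<Prod>i=1..n. run_length \<pi> i)"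
    by (rule prod.distrib)
  also have "(\<Prod>i=1..n. n + 1 - i) = fact n"
    using prod.atLeastAtMost_rev[of "\<lambda>i. i" 1 n] by (simp add: fact_prod)
  finally show ?thesis .
qed

section \<open>Summation over outcomes\<close>

lemma outcome_unique:
  assumes "subset_parking_with_outcome n \<pi> C" "subset_parking_with_outcome n \<sigma> C"
  shows "\<pi> = \<sigma>"
proof -
  have perm: "\<pi> permutes {1..n}" "\<sigma> permutes {1..n}"
    using assms by (auto simp: subset_parking_with_outcome_def)
  have in_range: "inv \<pi> i = inv \<sigma> i" if "i \<in> {1..n}" for i
    using that
  proof (induction i rule: less_induct)
    case (less i)
    have "inv \<pi> i' = inv \<sigma> i'" if "1 \<le> i' \<and> i' < i" for i'
      using less that by simp
    then have eq: "{inv \<pi> i' |i'. 1 \<le> i' \<and> i' < i} = {inv \<sigma> i' |i'. 1 \<le> i' \<and> i' < i}"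
      by metis
    have "is_smallest (inv \<pi> i) (C i - {inv \<pi> i' |i'. 1 \<le> i' \<and> i' < i})"
      "is_smallest (inv \<sigma> i) (C i - {inv \<sigma> i' |i'. 1 \<le> i' \<and> i' < i})"
      using assms less.prems by (simp_all add: subset_parking_with_outcome_def)
    then show ?case unfolding eq is_smallest_def by (blast intro: le_antisym)
  qed
  \<comment> \<open>Outside \<open>{1..n}\<close> both inverses fix every number.\<close>
  have "inv \<pi> i = inv \<sigma> i" for i
    using in_range permutes_not_in[OF permutes_inv[OF perm(1)]]
      permutes_not_in[OF permutes_inv[OF perm(2)]] by metis
  then have "inv \<pi> = inv \<sigma>" by blast
  then show ?thesis by (metis permutes_inv_inv perm)
qed

text \<open>Unlike \<open>IPF\<close>, \<open>PF\<close> is defined by counting tuples directly;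
  uniqueness of the outcome makes the classes for different outcomes disjoint.\<close>

lemma PF_eq_sum_outcomes: "PF n = (\<Sum>\<pi> | \<pi> permutes {1..n}. PF_outcome n \<pi>)"
proof -
  define P where "P \<pi> = {C. subset_parking_with_outcome n \<pi> C \<and> classical_tuple n C}" for \<pi>
  have "{C. subset_parking n C \<and> classical_tuple n C} = (\<Union>\<pi>\<in>{\<pi>. \<pi> permutes {1..n}}. P \<pi>)"
    by (auto simp: P_def subset_parking_def subset_parking_with_outcome_def)
  moreover have "finite (P \<pi>)" for \<pi>
  proof (rule finite_subset)
    show "P \<pi> \<subseteq> subset_tuples n" by (auto simp: P_def subset_parking_with_outcome_def)
    show "finite (subset_tuples n)" unfolding subset_tuples_def by (intro finite_PiE) auto
  qed
  moreover have "P \<pi> \<inter> P \<sigma> = {}" if "\<pi> \<noteq> \<sigma>" for \<pi> \<sigma>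
    using that outcome_unique by (auto simp: P_def)
  ultimately show ?thesis
    unfolding PF_def PF_outcome_def P_def[symmetric]
    by (simp add: card_UN_disjoint finite_permutations)
qed

section \<open>Pollak's circular parking\<close>

text \<open>The spots are the residues \<open>0, ..., m - 1\<close>, and the \<open>LEAST\<close> is
  the number of steps driven from \<open>c\<close>. It is meaningful only when some spot is
  free.\<close>

definition circ_park :: "nat \<Rightarrow> nat set \<Rightarrow> nat \<Rightarrow> nat" where
  "circ_park m S c = (c + (LEAST k. (c + k) mod m \<notin> S)) mod m"

primrec circ_occ :: "nat \<Rightarrow> (nat \<Rightarrow> nat) \<Rightarrow> nat \<Rightarrow> nat set" where
  "circ_occ m f 0 = {}"
| "circ_occ m f (Suc i) = insert (circ_park m (circ_occ m f i) (f (Suc i))) (circ_occ m f i)"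

lemma circ_park_witness:
  assumes "S \<subseteq> {..<m}" "card S < m" "c < m"
  obtains k where "circ_park m S c = (c + k) mod m" "(c + k) mod m \<notin> S"
    "\<And>j. j < k \<Longrightarrow> (c + j) mod m \<in> S"
proof -
  have "S \<noteq> {..<m}" using assms(2) by auto
  then obtain x where x: "x < m" "x \<notin> S" using assms(1) by auto
  \<comment> \<open>Driving \<open>m - c\<close> steps leads from \<open>c\<close> to spot 0, and
    \<open>x\<close> more lead to the free spot, so the search ends.\<close>
  have "(c + (m - c + x)) mod m \<notin> S" using x assms(3) by simp
  then have "(c + (LEAST k. (c + k) mod m \<notin> S)) mod m \<notin> S" by (rule LeastI)
  moreover have "(c + j) mod m \<in> S" if "j < (LEAST k. (c + k) mod m \<notin> S)" for j
    using not_less_Least[OF that] by blast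
  ultimately show thesis using that circ_park_def by blast
qed

text \<open>Before each of the first \<open>n\<close> cars arrives, fewer than \<open>m\<close>
  spots are taken, so it finds a free one and the count grows by exactly one.\<close>

lemma circ_occ_card:
  assumes "\<And>i. i \<in> {1..n} \<Longrightarrow> f i < m" "n \<le> m" "i \<le> n"
  shows "circ_occ m f i \<subseteq> {..<m} \<and> card (circ_occ m f i) = i"
  using assms(3)
proof (induction i)
  case 0
  then show ?case by simp
next
  case (Suc i)
  let ?S = "circ_occ m f i"
  have IH: "?S \<subseteq> {..<m}" "card ?S = i" using Suc by auto
  have "f (Suc i) < m" "card ?S < m" using assms Suc.prems IH by auto
  then obtain k where "circ_park m ?S (f (Suc i)) = (f (Suc i) + k) mod m"
      "(f (Suc i) + k) mod m \<notin> ?S"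
    using circ_park_witness[OF IH(1)] by blast
  moreover have "finite ?S" using IH finite_subset by blast
  ultimately show ?case using IH \<open>f (Suc i) < m\<close> by auto
qed

lemma circ_occ_mono: "i \<le> j \<Longrightarrow> circ_occ m f i \<subseteq> circ_occ m f j"
  by (rule lift_Suc_mono_le) auto

section \<open>Rotational symmetry and the empty spot\<close>

definition rot :: "nat \<Rightarrow> nat \<Rightarrow> nat \<Rightarrow> nat" where
  "rot m s x = (x + s) mod m"

lemma inj_on_rot: "inj_on (rot m s) {..<m}"
proof (rule inj_onI)
  fix x y assume "x \<in> {..<m}" "y \<in> {..<m}" "rot m s x = rot m s y"
  then have xy: "x < m" "y < m" and "[x + s = y + s] (mod m)"
    by (auto simp: rot_def cong_def)
  then have "[x = y] (mod m)" by (simp only: cong_add_rcancel_nat)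
  then show "x = y" using xy by (rule cong_less_modulus_unique_nat)
qed

text \<open>Rotation carries the search path from \<open>c\<close> to the path from
  \<open>rot m s c\<close> step by step. By injectivity it preserves which spots are free, so both
  searches take the same number of steps.\<close>

lemma circ_park_rot:
  assumes "S \<subseteq> {..<m}" "c < m"
  shows "circ_park m (rot m s ` S) (rot m s c) = rot m s (circ_park m S c)"
proof -
  have shift: "(rot m s c + k) mod m = rot m s ((c + k) mod m)" for k
    unfolding rot_def by (simp add: mod_simps ac_simps)
  have "(rot m s c + k) mod m \<in> rot m s ` S \<longleftrightarrow> (c + k) mod m \<in> S" for k
    unfolding shift using assms by (intro inj_on_image_mem_iff[OF inj_on_rot]) auto
  then show ?thesis unfolding circ_park_def by (simp add: shift)
qed

lemma circ_occ_rot: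
  assumes "\<And>i. i \<in> {1..n} \<Longrightarrow> f i < m" "\<And>i. i \<in> {1..n} \<Longrightarrow> g i = rot m s (f i)"
    "n \<le> m" "i \<le> n"
  shows "circ_occ m g i = rot m s ` circ_occ m f i"
  using assms(4)
proof (induction i)
  case (Suc i)
  then have "circ_occ m f i \<subseteq> {..<m}" using circ_occ_card[OF assms(1,3)] by auto
  then show ?case using Suc assms(1,2) by (simp add: circ_park_rot)
qed simp

definition leaves_empty :: "nat \<Rightarrow> nat \<Rightarrow> (nat \<Rightarrow> nat) set" where
  "leaves_empty n e = {f \<in> {1..n} \<rightarrow>\<^sub>E {..<n + 1}. e \<notin> circ_occ (n + 1) f n}"

text \<open>Rotating all preferences is injective and moves the empty spot from \<open>e\<close> to
  \<open>d\<close>. An inequality is enough, since \<open>e\<close> and \<open>d\<close> can be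
  swapped.\<close>

lemma card_leaves_empty_le:
  assumes "e < n + 1" "d < n + 1"
  shows "card (leaves_empty n e) \<le> card (leaves_empty n d)"
proof (rule card_inj_on_le)
  \<comment> \<open>This is \<open>d - e\<close> modulo \<open>n + 1\<close>; the added
    \<open>n + 1\<close> prevents truncated subtraction.\<close>
  define s where "s = n + 1 + d - e"
  define F where "F f = restrict (\<lambda>i. rot (n + 1) s (f i)) {1..n}" for f :: "nat \<Rightarrow> nat"
  have rot_e: "rot (n + 1) s e = d"
  proof -
    have "e + s = d + (n + 1)" using assms by (simp add: s_def)
    then show ?thesis using assms by (simp only: rot_def mod_add_self2 mod_less)
  qed
  show "inj_on F (leaves_empty n e)"
  proof (rule inj_onI)
    fix f g assume fg: "f \<in> leaves_empty n e" "g \<in> leaves_empty n e" "F f = F g"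
    have "f i = g i" if i: "i \<in> {1..n}" for i
    proof (rule inj_onD[OF inj_on_rot])
      show "rot (n + 1) s (f i) = rot (n + 1) s (g i)"
        using fun_cong[OF fg(3), of i] i by (simp add: F_def)
    qed (use fg i in \<open>auto simp: leaves_empty_def PiE_def Pi_def\<close>)
    then show "f = g" using fg by (auto simp: leaves_empty_def intro: PiE_ext)
  qed
  show "F ` leaves_empty n e \<subseteq> leaves_empty n d"
  proof
    fix g assume "g \<in> F ` leaves_empty n e"
    then obtain f where f: "f \<in> leaves_empty n e" "g = F f" by blast
    have fm: "\<And>i. i \<in> {1..n} \<Longrightarrow> f i < n + 1" using f by (auto simp: leaves_empty_def)
    have "circ_occ (n + 1) g n = rot (n + 1) s ` circ_occ (n + 1) f n"
      by (rule circ_occ_rot[OF fm]) (auto simp: f F_def)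
    moreover have "d \<notin> rot (n + 1) s ` circ_occ (n + 1) f n"
    proof -
      have "circ_occ (n + 1) f n \<subseteq> {..<n + 1}" using circ_occ_card[OF fm] by auto
      then have "rot (n + 1) s e \<notin> rot (n + 1) s ` circ_occ (n + 1) f n"
        using f(1) assms inj_on_image_mem_iff[OF inj_on_rot, of e "n + 1" "circ_occ (n + 1) f n" s]
        by (simp add: leaves_empty_def)
      then show ?thesis unfolding rot_e .
    qed
    moreover have "g \<in> {1..n} \<rightarrow>\<^sub>E {..<n + 1}" by (auto simp: f F_def rot_def)
    ultimately show "g \<in> leaves_empty n d" by (simp add: leaves_empty_def)
  qed
  show "finite (leaves_empty n d)"
    by (rule finite_subset[of _ "{1..n} \<rightarrow>\<^sub>E {..<n + 1}"])
      (auto simp: leaves_empty_def intro!: finite_PiE)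
qed

text \<open>Exactly one of the \<open>n + 1\<close> spots stays empty, so the
  \<open>(n + 1) ^ n\<close> preference functions split into \<open>n + 1\<close> classes, all of
  the same size by rotation.\<close>

lemma card_leaves_empty:
  assumes "1 \<le> n" "e < n + 1"
  shows "card (leaves_empty n e) = (n + 1) ^ (n - 1)"
proof -
  define A where "A = {1..n} \<rightarrow>\<^sub>E {..<n + 1}"
  have finA: "finite A" unfolding A_def by (intro finite_PiE) auto
  have "A = (\<Union>d\<in>{..<n + 1}. leaves_empty n d)"
  proof
    show "A \<subseteq> (\<Union>d\<in>{..<n + 1}. leaves_empty n d)"
    proof
      fix f assume f: "f \<in> A"
      then have "\<And>i. i \<in> {1..n} \<Longrightarrow> f i < n + 1" by (auto simp: A_def)
      then have "circ_occ (n + 1) f n \<subseteq> {..<n + 1} \<and> card (circ_occ (n + 1) f n) = n"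
        by (rule circ_occ_card) auto
      then have "\<exists>d<n + 1. d \<notin> circ_occ (n + 1) f n"
        by (metis card_lessThan lessThan_iff less_add_one less_irrefl subsetI subset_antisym)
      then show "f \<in> (\<Union>d\<in>{..<n + 1}. leaves_empty n d)"
        using f by (auto simp: leaves_empty_def A_def)
    qed
  qed (auto simp: leaves_empty_def A_def)
  moreover have "leaves_empty n c \<inter> leaves_empty n d = {}"
    if cd: "c < n + 1" "d < n + 1" "c \<noteq> d" for c d
  proof (rule ccontr)
    assume "leaves_empty n c \<inter> leaves_empty n d \<noteq> {}"
    then obtain f where f: "f \<in> {1..n} \<rightarrow>\<^sub>E {..<n + 1}"
      "c \<notin> circ_occ (n + 1) f n" "d \<notin> circ_occ (n + 1) f n"
      by (auto simp: leaves_empty_def)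
    then have "\<And>i. i \<in> {1..n} \<Longrightarrow> f i < n + 1" by auto
    then have occ: "circ_occ (n + 1) f n \<subseteq> {..<n + 1} \<and> card (circ_occ (n + 1) f n) = n"
      by (rule circ_occ_card) auto
    \<comment> \<open>Two empty spots would leave only \<open>n - 1\<close> spots for
      \<open>n\<close> cars.\<close>
    then have "circ_occ (n + 1) f n \<subseteq> {..<n + 1} - {c, d}" using f by blast
    then have "card (circ_occ (n + 1) f n) \<le> card ({..<n + 1} - {c, d})"
      by (intro card_mono) auto
    also have "\<dots> = n - 1" using cd by (subst card_Diff_subset) auto
    finally show False using occ assms(1) by simp
  qed
  moreover have "finite (leaves_empty n d)" for d
    by (rule finite_subset[OF _ finA]) (auto simp: leaves_empty_def A_def)
  ultimately have "card A = (\<Sum>d<n + 1. card (leaves_empty n d))"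
    by (simp only:, subst card_UN_disjoint) auto
  also have "\<dots> = (\<Sum>d<n + 1. card (leaves_empty n e))"
    by (rule sum.cong) (use assms(2) in \<open>auto intro!: le_antisym card_leaves_empty_le\<close>)
  finally have "(n + 1) ^ n = (n + 1) * card (leaves_empty n e)"
    by (simp add: A_def card_PiE)
  moreover have "(n + 1) ^ n = (n + 1) * (n + 1) ^ (n - 1)"
    using assms(1) by (metis Suc_diff_1 less_eq_Suc_le One_nat_def power_Suc)
  ultimately show ?thesis by (metis add_gr_0 less_numeral_extra(1) mult_left_cancel less_irrefl)
qed

section \<open>Circular and linear parking\<close>

text \<open>A car that meets the free spot 0 parks there. If 0 is still free afterwards, the car
  neither started at 0 nor wrapped around, so its search was linear.\<close>

lemma circ_park_eq_smallest:
  assumes "S \<subseteq> {..<n + 1}" "card S < n + 1" "c < n + 1"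
    "0 \<notin> S" "circ_park (n + 1) S c \<noteq> 0"
  shows "1 \<le> c" "is_smallest (circ_park (n + 1) S c) ({c..n} - S)"
proof -
  obtain k where k: "circ_park (n + 1) S c = (c + k) mod (n + 1)" "(c + k) mod (n + 1) \<notin> S"
    "\<And>j. j < k \<Longrightarrow> (c + j) mod (n + 1) \<in> S"
    using circ_park_witness[OF assms(1-3)] by blast
  show c: "1 \<le> c"
  proof (rule ccontr)
    assume "\<not> 1 \<le> c"
    then have "c = 0" by simp
    then show False using k(1) k(3)[of 0] assms(4,5) by (cases "k = 0") auto
  qed
  have le: "c + k \<le> n"
  proof (rule ccontr)
    assume "\<not> c + k \<le> n"
    \<comment> \<open>After \<open>n + 1 - c\<close> steps the car is at spot 0: stopping there
      contradicts the final spot being nonzero, and driving past it contradicts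
      \<open>0 \<notin> S\<close>.\<close>
    then have "n + 1 - c \<le> k" by simp
    moreover have "(c + (n + 1 - c)) mod (n + 1) = 0" using assms(3) by simp
    then have "n + 1 - c \<noteq> k" "\<not> n + 1 - c < k"
      using k(1) k(3) assms(4,5) by metis+
    ultimately show False by simp
  qed
  have "c + k \<le> y" if "y \<in> {c..n} - S" for y
    using k(3)[of "y - c"] that by (force simp: not_le)
  then show "is_smallest (circ_park (n + 1) S c) ({c..n} - S)"
    using k le by (auto simp: is_smallest_def)
qed

text \<open>Conversely, a linear search that succeeds within \<open>{c..n}\<close> ends before any
  wrap-around.\<close>

lemma circ_park_eqI:
  assumes "is_smallest x ({c..n} - S)"
  shows "circ_park (n + 1) S c = x"
proof -
  have x: "c \<le> x" "x \<le> n" "x \<notin> S" "\<And>y. c \<le> y \<Longrightarrow> y \<le> n \<Longrightarrow> y \<notin> S \<Longrightarrow> x \<le> y"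
    using assms by (auto simp: is_smallest_def)
  have "(LEAST k. (c + k) mod (n + 1) \<notin> S) = x - c"
  proof (rule Least_equality)
    show "(c + (x - c)) mod (n + 1) \<notin> S" using x by simp
  next
    fix k assume k: "(c + k) mod (n + 1) \<notin> S"
    show "x - c \<le> k"
    proof (rule ccontr)
      assume "\<not> x - c \<le> k"
      then have "c + k < x" by simp
      then show False using x(4)[of "c + k"] x(2) k by simp
    qed
  qed
  then show ?thesis unfolding circ_park_def using x by simp
qed

text \<open>Identifies preference functions with classical tuples; \<open>restrict\<close> supplies
  the value \<open>undefined\<close> outside \<open>{1..n}\<close> that \<open>subset_tuples\<close>
  demands.\<close>

definition tails :: "nat \<Rightarrow> (nat \<Rightarrow> nat) \<Rightarrow> nat \<Rightarrow> nat set" where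
  "tails n f = restrict (\<lambda>i. {f i..n}) {1..n}"

lemma tails_parking_imp_leaves_empty:
  assumes "f \<in> {1..n} \<rightarrow>\<^sub>E {1..n}" "subset_parking_with_outcome n \<pi> (tails n f)"
  shows "f \<in> leaves_empty n 0"
proof -
  have perm: "\<pi> permutes {1..n}" using assms(2) by (simp add: subset_parking_with_outcome_def)
  \<comment> \<open>The bound \<open>Suc i\<close> gives the set in the form in which the outcome
    condition for car \<open>Suc i\<close> removes it.\<close>
  have "circ_occ (n + 1) f i = {inv \<pi> i' |i'. 1 \<le> i' \<and> i' < Suc i}" if "i \<le> n" for i
    using that
  proof (induction i)
    case (Suc i)
    then have "is_smallest (inv \<pi> (Suc i)) ({f (Suc i)..n} - circ_occ (n + 1) f i)"
      using assms(2) by (auto simp: subset_parking_with_outcome_def tails_def)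
    then have "circ_park (n + 1) (circ_occ (n + 1) f i) (f (Suc i)) = inv \<pi> (Suc i)"
      by (rule circ_park_eqI)
    then show ?case using Suc by (auto simp: less_Suc_eq)
  qed auto
  then have "circ_occ (n + 1) f n \<subseteq> {1..n}"
    using permutes_in_image[OF permutes_inv[OF perm]] by fastforce
  moreover have "f \<in> {1..n} \<rightarrow>\<^sub>E {..<n + 1}"
    using assms(1) by (auto simp: PiE_def Pi_def less_Suc_eq_le)
  ultimately show ?thesis by (auto simp: leaves_empty_def)
qed

text \<open>With spot 0 empty throughout, every circular search is linear. The cars fill
  \<open>{1..n}\<close> bijectively, and the outcome is the inverse of the map from cars to
  spots.\<close>

lemma leaves_empty_imp_tails_parking:
  assumes "f \<in> leaves_empty n 0"
  shows "f \<in> {1..n} \<rightarrow>\<^sub>E {1..n} \<and> subset_parking n (tails n f)"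
proof -
  define p where "p i = circ_park (n + 1) (circ_occ (n + 1) f (i - 1)) (f i)" for i
  have f: "f \<in> {1..n} \<rightarrow>\<^sub>E {..<n + 1}" and empty: "0 \<notin> circ_occ (n + 1) f n"
    using assms by (auto simp: leaves_empty_def)
  have fm: "\<And>i. i \<in> {1..n} \<Longrightarrow> f i < n + 1" using f by auto
  have occ: "circ_occ (n + 1) f i = p ` {1..i}" for i
    by (induction i) (auto simp: p_def atLeastAtMostSuc_conv)
  have occ_card: "circ_occ (n + 1) f i \<subseteq> {..<n + 1} \<and> card (circ_occ (n + 1) f i) = i" if "i \<le> n" for i
    by (rule circ_occ_card[OF fm _ that]) auto
  have park: "1 \<le> f i \<and> is_smallest (p i) ({f i..n} - p ` {1..<i})" if i: "i \<in> {1..n}" for i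
  proof -
    let ?S = "circ_occ (n + 1) f (i - 1)"
    have "?S \<subseteq> {..<n + 1} \<and> card ?S = i - 1" by (rule occ_card) (use i in auto)
    moreover have "0 \<notin> ?S"
    proof -
      have "i - 1 \<le> n" using i by auto
      then show ?thesis using empty circ_occ_mono by blast
    qed
    moreover have "p i \<noteq> 0" using empty i unfolding occ by force
    moreover have "p ` {1..<i} = ?S" unfolding occ using i by (intro image_cong) auto
    ultimately show ?thesis
      using circ_park_eq_smallest[of ?S n "f i"] fm[OF i] i by (auto simp: p_def)
  qed
  have f1: "f \<in> {1..n} \<rightarrow>\<^sub>E {1..n}"
    using f park fm by (auto simp: PiE_def Pi_def less_Suc_eq_le)
  \<comment> \<open>The \<open>n\<close> cars occupy \<open>n\<close> spots, which forces
    \<open>p\<close> to be injective.\<close>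
  have "card (p ` {1..n}) = n" using occ_card[of n] unfolding occ by simp
  then have inj: "inj_on p {1..n}" by (simp add: eq_card_imp_inj_on)
  have "p ` {1..n} \<subseteq> {1..n}"
  proof
    fix x assume "x \<in> p ` {1..n}"
    then obtain i where "i \<in> {1..n}" "x = p i" by blast
    then show "x \<in> {1..n}" using park[of i] by (auto simp: is_smallest_def)
  qed
  then have bij: "bij_betw p {1..n} {1..n}"
    using inj by (simp add: bij_betw_def endo_inj_surj)
  \<comment> \<open>Extending \<open>p\<close> by the identity makes it a permutation in the sense
    of \<open>permutes\<close>.\<close>
  define q where "q i = (if i \<in> {1..n} then p i else i)" for i
  have q: "q permutes {1..n}"
  proof (rule bij_imp_permutes)
    show "bij_betw q {1..n} {1..n}"
      using bij by (subst bij_betw_cong[of _ _ p]) (simp_all add: q_def)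
  qed (auto simp: q_def)
  \<comment> \<open>Since \<open>q\<close> sends cars to spots while an outcome sends spots to cars,
    the outcome is \<open>inv q\<close>.\<close>
  have inv_inv: "inv (inv q) = q" by (rule permutes_inv_inv[OF q])
  have "tails n f \<in> subset_tuples n"
    using f1 by (auto simp: tails_def subset_tuples_def PiE_def Pi_def)
  moreover have "is_smallest (q i) (tails n f i - {q i' |i'. 1 \<le> i' \<and> i' < i})"
    if i: "i \<in> {1..n}" for i
  proof -
    have "{q i' |i'. 1 \<le> i' \<and> i' < i} = p ` {1..<i}"
      using i by (force simp: q_def)
    then show ?thesis using park[OF i] i by (simp add: q_def tails_def)
  qed
  ultimately have "subset_parking_with_outcome n (inv q) (tails n f)"
    unfolding subset_parking_with_outcome_def inv_inv using permutes_inv[OF q] by blast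
  then show ?thesis using f1 by (auto simp: subset_parking_def)
qed

text \<open>Taking tails matches the preference functions leaving spot 0 empty with the classical
  parking functions, so the count is the size of one rotation class.\<close>

lemma PF_eq:
  assumes "1 \<le> n"
  shows "PF n = (n + 1) ^ (n - 1)"
proof -
  have "bij_betw (tails n) (leaves_empty n 0) {C. subset_parking n C \<and> classical_tuple n C}"
    unfolding bij_betw_def
  proof
    show "inj_on (tails n) (leaves_empty n 0)"
    proof (rule inj_onI)
      fix f g assume fg: "f \<in> leaves_empty n 0" "g \<in> leaves_empty n 0" "tails n f = tails n g"
      then have fg': "f \<in> {1..n} \<rightarrow>\<^sub>E {1..n}" "g \<in> {1..n} \<rightarrow>\<^sub>E {1..n}"
        using leaves_empty_imp_tails_parking by blast+
      have "f i = g i" if i: "i \<in> {1..n}" for i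
      proof -
        have "{f i..n} = {g i..n}" using fun_cong[OF fg(3), of i] i by (simp add: tails_def)
        moreover have "f i \<le> n" "g i \<le> n" using fg' i by auto
        ultimately show ?thesis by (simp add: Icc_eq_Icc)
      qed
      then show "f = g" using fg' by (auto intro: PiE_ext)
    qed
    show "tails n ` leaves_empty n 0 = {C. subset_parking n C \<and> classical_tuple n C}"
    proof
      show "tails n ` leaves_empty n 0 \<subseteq> {C. subset_parking n C \<and> classical_tuple n C}"
        using leaves_empty_imp_tails_parking
        by (fastforce simp: classical_tuple_def tails_def)
      show "{C. subset_parking n C \<and> classical_tuple n C} \<subseteq> tails n ` leaves_empty n 0"
      proof
        fix C assume C: "C \<in> {C. subset_parking n C \<and> classical_tuple n C}"
        then obtain \<pi> where pi: "subset_parking_with_outcome n \<pi> C"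
          by (auto simp: subset_parking_def)
        \<comment> \<open>A choice of left ends recovers the preference function from the
          tuple.\<close>
        from C obtain c where c: "\<forall>i\<in>{1..n}. c i \<in> {1..n} \<and> C i = {c i..n}"
          unfolding classical_tuple_def by (auto simp: Bex_def dest!: bchoice)
        define f where "f = restrict c {1..n}"
        have "C \<in> extensional {1..n}"
          using pi by (auto simp: subset_parking_with_outcome_def subset_tuples_def PiE_def)
        then have "C = tails n f"
          using c by (auto simp: tails_def f_def extensional_def fun_eq_iff)
        moreover have "f \<in> {1..n} \<rightarrow>\<^sub>E {1..n}" using c by (auto simp: f_def)
        ultimately show "C \<in> tails n ` leaves_empty n 0"
          using tails_parking_imp_leaves_empty pi by blast
      qed
    qed
  qed
  then have "PF n = card (leaves_empty n 0)"
    unfolding PF_def by (simp add: bij_betw_same_card)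
  then show ?thesis using card_leaves_empty[OF assms] by simp
qed

theorem theorem1p3:
  fixes n :: nat
  assumes "n \<ge> 1"
  shows "(\<forall>\<pi>. \<pi> permutes {1..n} \<longrightarrow>
            IPF_outcome n \<pi> = fact n * PF_outcome n \<pi> \<and>
            fact n * PF_outcome n \<pi> = fact n * (\<Prod>i=1..n. run_length \<pi> i)) \<and>
         IPF n = fact n * PF n \<and>
         fact n * PF n = fact n * (n + 1) ^ (n - 1)"
proof -
  \<comment> \<open>The factor \<open>fact n\<close> is the same for every outcome, so it can be
    pulled out of the sum.\<close>
  have "IPF n = fact n * PF n"
    unfolding IPF_def PF_eq_sum_outcomes sum_distrib_left
    by (rule sum.cong) (simp_all add: IPF_outcome_eq PF_outcome_eq)
  then show ?thesis using assms by (simp add: IPF_outcome_eq PF_outcome_eq PF_eq)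
qed

end
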